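(* There is a monoidal natural transformation $\mathsf{subg}\colon\mathsf{Conv}\Rightarrow\mathsf{NDD}$ whose component at a finite set $N$, $\mathsf{subg}_N\colon\mathsf{Conv}(N)\to\mathsf{NDD}(N)$, is given by $f\mapsto-\partial f$, i.e. $\mathsf{subg}_N(f)(x)=\{-v\mid v\in\partial f(x)\}$.
   Context: $(\mathbf{FinSet},+)$ is finite sets with disjoint union as monoidal product; $(\mathbf{Set},\times)$ is sets with Cartesian product. For a finite set $N$, $\mathbb{R}^N$ is the vector space of functions $N\to\mathbb{R}$. For $\phi\colon N\to M$, $\phi^*\colon\mathbb{R}^M\to\mathbb{R}^N$ is $\phi^*(y)_i=y_{\phi(i)}$ and $\phi_*\colon\mathbb{R}^N\to\mathbb{R}^M$ is $\phi_*(x)_j=\sum_{i\in\phi^{-1}(j)}x_i$. $\iota_N,\iota_M$ are the inclusions of $N,M$ into $N+M$. $P$ is the covariant powerset functor ($P(f)(A)$ is the image of $A$ under $f$). $A\boxplus B=\{a+b\mid a\in A,b\in B\}$ is the Minkowski sum, applied pointwise to set-valued functions. For convex $f\colon\mathbb{R}^N\to\mathbb{R}$, the subdifferential $\partial f(x)$ is the set of $v\in\mathbb{R}^N$ with $f(y)-f(x)\ge v^T(y-x)$ for all $y\in\mathbb{R}^N$. $\mathsf{Conv}\colon(\mathbf{FinSet},+)\to(\mathbf{Set},\times)$ is the lax symmetric monoidal functor with $\mathsf{Conv}(N)$ the set of convex functions $f\colon\mathbb{R}^N\to\mathbb{R}$ (not necessarily differentiable); $\mathsf{Conv}(\phi)(f)=f\circ\phi^*$;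 product comparison $(f,g)\mapsto f\circ\iota_N^*+g\circ\iota_M^*$; unit comparison picking the zero function on $\mathbb{R}^0$. $\mathsf{NDD}\colon(\mathbf{FinSet},+)\to(\mathbf{Set},\times)$ is the lax symmetric monoidal functor with $\mathsf{NDD}(N)$ the set of functions $\mathbb{R}^N\to P\mathbb{R}^N$; $\mathsf{NDD}(\phi)(\upsilon)=P\phi_*\circ\upsilon\circ\phi^*$; product comparison $(\upsilon,\rho)\mapsto(P\iota_{N*}\circ\upsilon\circ\iota_N^* )\boxplus(P\iota_{M*}\circ\rho\circ\iota_M^* )$; unit comparison picking the function $0\mapsto\{0\}$ on $\mathbb{R}^0$. *)

theory Defs
  imports "HOL-Analysis.Analysis" "HOL-Analysis.Finite_Function_Topology"
begin

section \<open>The symmetric monoidal category of finite sets\<close>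

text \<open>
  Objects of (FinSet, +) are the finite subsets of the type below, the closure of an arbitrary
  type of atoms under two tagging operations.  The tags make the literal disjoint union of two
  objects an object again, and the empty set is the monoidal unit.  Since a map between sets is
  an element of \<open>N \<rightarrow>\<^sub>E M\<close> (arbitrary on \<open>N\<close>, fixed to \<open>undefined\<close> elsewhere), equality of maps is
  equality in the logic.
\<close>

datatype 'a elem = Atom 'a | InL "'a elem" | InR "'a elem"

definition dsum :: "'a elem set \<Rightarrow> 'a elem set \<Rightarrow> 'a elem set"
  where "dsum N M = InL ` N \<union> InR ` M"

fun copair :: "('a elem \<Rightarrow> 'b) \<Rightarrow> ('a elem \<Rightarrow> 'b) \<Rightarrow> 'a elem \<Rightarrow> 'b"
  where
    "copair f g (InL i) = f i"
  | "copair f g (InR j) = g j"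
  | "copair f g (Atom a) = undefined"

definition dsum_map ::
    "'a elem set \<Rightarrow> 'a elem set \<Rightarrow> ('a elem \<Rightarrow> 'a elem) \<Rightarrow> ('a elem \<Rightarrow> 'a elem) \<Rightarrow> 'a elem \<Rightarrow> 'a elem"
  where "dsum_map N M \<phi> \<psi> = restrict (copair (InL \<circ> \<phi>) (InR \<circ> \<psi>)) (dsum N M)"

definition dsum_assoc :: "'a elem set \<Rightarrow> 'a elem set \<Rightarrow> 'a elem set \<Rightarrow> 'a elem \<Rightarrow> 'a elem"
  where "dsum_assoc N M K =
    restrict (copair (copair InL (InR \<circ> InL)) (InR \<circ> InR)) (dsum (dsum N M) K)"

definition dsum_lunit :: "'a elem set \<Rightarrow> 'a elem \<Rightarrow> 'a elem"
  where "dsum_lunit N = restrict (copair undefined id) (dsum {} N)"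

definition dsum_runit :: "'a elem set \<Rightarrow> 'a elem \<Rightarrow> 'a elem"
  where "dsum_runit N = restrict (copair id undefined) (dsum N {})"

definition dsum_swap :: "'a elem set \<Rightarrow> 'a elem set \<Rightarrow> 'a elem \<Rightarrow> 'a elem"
  where "dsum_swap N M = restrict (copair InR InL) (dsum N M)"


section \<open>Lax symmetric monoidal functors from finite sets to sets\<close>

text \<open>
  The data of such a functor: its action on objects and on maps \<open>\<phi> \<in> N \<rightarrow>\<^sub>E M\<close>, the product
  comparisons \<open>F N \<times> F M \<rightarrow> F (N + M)\<close> and the unit comparison \<open>1 \<rightarrow> F \<emptyset>\<close>.  Objects of Set are the
  subsets of a type; products and the one-point set are those of the logic, so the coherence
  diagrams are written out on elements.
\<close>

record ('a, 'v) set_functor =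
  Ob :: "'a elem set \<Rightarrow> 'v set"
  Mor :: "'a elem set \<Rightarrow> 'a elem set \<Rightarrow> ('a elem \<Rightarrow> 'a elem) \<Rightarrow> 'v \<Rightarrow> 'v"
  ProdCmp :: "'a elem set \<Rightarrow> 'a elem set \<Rightarrow> 'v \<times> 'v \<Rightarrow> 'v"
  UnitCmp :: "unit \<Rightarrow> 'v"

locale lax_symmetric_monoidal_functor =
  fixes F :: "('a, 'v) set_functor"
  assumes Mor_in:
      "\<lbrakk>finite N; finite M; \<phi> \<in> N \<rightarrow>\<^sub>E M\<rbrakk> \<Longrightarrow> Mor F N M \<phi> \<in> Ob F N \<rightarrow>\<^sub>E Ob F M"
    and Mor_id:
      "finite N \<Longrightarrow> Mor F N N (restrict id N) = restrict id (Ob F N)"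
    and Mor_comp:
      "\<lbrakk>finite N; finite M; finite K; \<phi> \<in> N \<rightarrow>\<^sub>E M; \<psi> \<in> M \<rightarrow>\<^sub>E K\<rbrakk>
        \<Longrightarrow> Mor F N K (compose N \<psi> \<phi>) = compose (Ob F N) (Mor F M K \<psi>) (Mor F N M \<phi>)"
    and ProdCmp_in:
      "\<lbrakk>finite N; finite M\<rbrakk> \<Longrightarrow> ProdCmp F N M \<in> Ob F N \<times> Ob F M \<rightarrow>\<^sub>E Ob F (dsum N M)"
    and UnitCmp_in:
      "UnitCmp F () \<in> Ob F {}"
    and ProdCmp_natural:
      "\<lbrakk>finite N; finite N'; finite M; finite M'; \<phi> \<in> N \<rightarrow>\<^sub>E N'; \<psi> \<in> M \<rightarrow>\<^sub>E M'; x \<in> Ob F N; y \<in> Ob F M\<rbrakk>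
        \<Longrightarrow> Mor F (dsum N M) (dsum N' M') (dsum_map N M \<phi> \<psi>) (ProdCmp F N M (x, y)) =
            ProdCmp F N' M' (Mor F N N' \<phi> x, Mor F M M' \<psi> y)"
    and ProdCmp_assoc:
      "\<lbrakk>finite N; finite M; finite K; x \<in> Ob F N; y \<in> Ob F M; z \<in> Ob F K\<rbrakk>
        \<Longrightarrow> Mor F (dsum (dsum N M) K) (dsum N (dsum M K)) (dsum_assoc N M K)
              (ProdCmp F (dsum N M) K (ProdCmp F N M (x, y), z)) =
            ProdCmp F N (dsum M K) (x, ProdCmp F M K (y, z))"
    and ProdCmp_lunit:
      "\<lbrakk>finite N; x \<in> Ob F N\<rbrakk>
        \<Longrightarrow> Mor F (dsum {} N) N (dsum_lunit N) (ProdCmp F {} N (UnitCmp F (), x)) = x"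
    and ProdCmp_runit:
      "\<lbrakk>finite N; x \<in> Ob F N\<rbrakk>
        \<Longrightarrow> Mor F (dsum N {}) N (dsum_runit N) (ProdCmp F N {} (x, UnitCmp F ())) = x"
    and ProdCmp_sym:
      "\<lbrakk>finite N; finite M; x \<in> Ob F N; y \<in> Ob F M\<rbrakk>
        \<Longrightarrow> Mor F (dsum N M) (dsum M N) (dsum_swap N M) (ProdCmp F N M (x, y)) =
            ProdCmp F M N (y, x)"

locale monoidal_natural_transformation =
  F: lax_symmetric_monoidal_functor F + G: lax_symmetric_monoidal_functor G
  for F :: "('a, 'v) set_functor" and G :: "('a, 'w) set_functor" +
  fixes \<alpha> :: "'a elem set \<Rightarrow> 'v \<Rightarrow> 'w"
  assumes component_in:
      "finite N \<Longrightarrow> \<alpha> N \<in> Ob F N \<rightarrow>\<^sub>E Ob G N"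
    and naturality:
      "\<lbrakk>finite N; finite M; \<phi> \<in> N \<rightarrow>\<^sub>E M\<rbrakk>
        \<Longrightarrow> compose (Ob F N) (\<alpha> M) (Mor F N M \<phi>) = compose (Ob F N) (Mor G N M \<phi>) (\<alpha> N)"
    and monoidal_product:
      "\<lbrakk>finite N; finite M; x \<in> Ob F N; y \<in> Ob F M\<rbrakk>
        \<Longrightarrow> \<alpha> (dsum N M) (ProdCmp F N M (x, y)) = ProdCmp G N M (\<alpha> N x, \<alpha> M y)"
    and monoidal_unit:
      "\<alpha> {} (UnitCmp F ()) = UnitCmp G ()"


section \<open>The functors \<open>Conv\<close> and \<open>NDD\<close>\<close>

text \<open>
  A function from the finite set \<open>N\<close> to the reals is represented by its extension by zero, which
  gives access to the library's vector space operations and to \<^const>\<open>convex_on\<close>.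
\<close>

definition RR :: "'i set \<Rightarrow> ('i \<Rightarrow>\<^sub>0 real) set"
  where "RR N = {x. Poly_Mapping.keys x \<subseteq> N}"

text \<open>
  \<open>pullback N \<phi>\<close> and \<open>pushforward N M \<phi>\<close> are \<open>\<phi>\<^sup>*\<close> and \<open>\<phi>\<^sub>*\<close> for \<open>\<phi>\<close> from \<open>N\<close> to \<open>M\<close>; the arguments of
  \<^const>\<open>Abs_poly_mapping\<close> have finite support because \<open>N\<close> and \<open>M\<close> are finite.
\<close>

definition pullback :: "'i set \<Rightarrow> ('i \<Rightarrow> 'j) \<Rightarrow> ('j \<Rightarrow>\<^sub>0 real) \<Rightarrow> ('i \<Rightarrow>\<^sub>0 real)"
  where "pullback N \<phi> y =
    Abs_poly_mapping (\<lambda>i. if i \<in> N then Poly_Mapping.lookup y (\<phi> i) else 0)"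

definition pushforward :: "'i set \<Rightarrow> 'j set \<Rightarrow> ('i \<Rightarrow> 'j) \<Rightarrow> ('i \<Rightarrow>\<^sub>0 real) \<Rightarrow> ('j \<Rightarrow>\<^sub>0 real)"
  where "pushforward N M \<phi> x =
    Abs_poly_mapping (\<lambda>j. if j \<in> M then (\<Sum>i\<in>{i\<in>N. \<phi> i = j}. Poly_Mapping.lookup x i) else 0)"

definition subdifferential ::
    "'i set \<Rightarrow> (('i \<Rightarrow>\<^sub>0 real) \<Rightarrow> real) \<Rightarrow> ('i \<Rightarrow>\<^sub>0 real) \<Rightarrow> ('i \<Rightarrow>\<^sub>0 real) set"
  where "subdifferential N f x =
    {v \<in> RR N. \<forall>y\<in>RR N.
       f y - f x \<ge> (\<Sum>i\<in>N. Poly_Mapping.lookup v i * Poly_Mapping.lookup (y - x) i)}"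

definition Conv_ob :: "'a elem set \<Rightarrow> (('a elem \<Rightarrow>\<^sub>0 real) \<Rightarrow> real) set"
  where "Conv_ob N = {f \<in> RR N \<rightarrow>\<^sub>E UNIV. convex_on (RR N) f}"

definition Conv :: "('a, ('a elem \<Rightarrow>\<^sub>0 real) \<Rightarrow> real) set_functor"
  where "Conv = \<lparr>
    Ob = Conv_ob,
    Mor = (\<lambda>N M \<phi>. \<lambda>f\<in>Conv_ob N. \<lambda>y\<in>RR M. f (pullback N \<phi> y)),
    ProdCmp = (\<lambda>N M. \<lambda>(f, g)\<in>Conv_ob N \<times> Conv_ob M.
      \<lambda>x\<in>RR (dsum N M). f (pullback N InL x) + g (pullback M InR x)),
    UnitCmp = (\<lambda>_. \<lambda>x\<in>RR {}. 0)\<rparr>"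

definition NDD_ob :: "'a elem set \<Rightarrow> (('a elem \<Rightarrow>\<^sub>0 real) \<Rightarrow> ('a elem \<Rightarrow>\<^sub>0 real) set) set"
  where "NDD_ob N = RR N \<rightarrow>\<^sub>E Pow (RR N)"

text \<open>The sum of two sets in the product comparison is the Minkowski sum of
  \<^theory>\<open>HOL-Library.Set_Algebras\<close>.\<close>

definition NDD :: "('a, ('a elem \<Rightarrow>\<^sub>0 real) \<Rightarrow> ('a elem \<Rightarrow>\<^sub>0 real) set) set_functor"
  where "NDD = \<lparr>
    Ob = NDD_ob,
    Mor = (\<lambda>N M \<phi>. \<lambda>\<upsilon>\<in>NDD_ob N. \<lambda>y\<in>RR M. pushforward N M \<phi> ` \<upsilon> (pullback N \<phi> y)),
    ProdCmp = (\<lambda>N M. \<lambda>(\<upsilon>, \<rho>)\<in>NDD_ob N \<times> NDD_ob M.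
      \<lambda>x\<in>RR (dsum N M).
        pushforward N (dsum N M) InL ` \<upsilon> (pullback N InL x) +
        pushforward M (dsum N M) InR ` \<rho> (pullback M InR x)),
    UnitCmp = (\<lambda>_. \<lambda>x\<in>RR {}. {0})\<rparr>"

end

theory Submission
  imports Defs
begin

text \<open>
  The substance lies in naturality.  The functor laws hold because \<open>\<phi> \<mapsto> \<phi>\<^sup>*\<close> is contravariantly and
  \<open>\<phi> \<mapsto> \<phi>\<^sub>*\<close> covariantly functorial, and because linear maps preserve convexity under precomposition
  and commute with Minkowski sums.  They also commute with negation, so that the sign passes through
  the two squares for the transformation and these become statements about \<open>\<partial>f\<close> itself.

  The monoidal square is the sum rule for functions of separate variables
  (\<open>subdifferential_separable_sum\<close>): with the biproduct structure of \<open>\<real>\<^sup>N\<^sup>+\<^sup>M\<close>, a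
  subgradient of the sum is tested by moving one of the two components while the other stays put.

  The naturality square is the chain rule \<open>\<partial>(f \<circ> \<phi>\<^sup>*)(y) = \<phi>\<^sub>* (\<partial>f(\<phi>\<^sup>* y))\<close>
  (\<open>subdifferential_pullback\<close>).  The inclusion from right to left is the adjunction
  \<open>\<langle>\<phi>\<^sub>* v, u\<rangle> = \<langle>v, \<phi>\<^sup>* u\<rangle>\<close>.  For the other one, let \<open>w\<close> be a subgradient of \<open>f \<circ> \<phi>\<^sup>*\<close> at \<open>y\<close> and
  put \<open>p h = f (\<phi>\<^sup>* y + h) - f (\<phi>\<^sup>* y)\<close>, a finite convex function with \<open>\<langle>w, u\<rangle> \<le> p (\<phi>\<^sup>* u)\<close> for all
  \<open>u\<close>.  If \<open>\<phi>\<^sup>* u = 0\<close>, applying this to \<open>u\<close> and \<open>- u\<close> gives \<open>\<langle>w, u\<rangle> = 0\<close>; hence \<open>w\<close> descends to a linear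
  functional on the range of \<open>\<phi>\<^sup>*\<close>, where it lies below \<open>p\<close>.  The Hahn-Banach theorem for a convex
  bound (\<open>convex_dominated_extension\<close>) extends it to all of \<open>\<real>\<^sup>N\<close>, still below \<open>p\<close>.  The vector \<open>v\<close>
  representing the extension is a subgradient of \<open>f\<close> at \<open>\<phi>\<^sup>* y\<close>, and \<open>\<phi>\<^sub>* v = w\<close> because the
  extension agrees with \<open>w\<close> on the range of \<open>\<phi>\<^sup>*\<close>.
\<close>

section \<open>Dominated extension of linear functionals\<close>

text \<open>
  The value \<open>c\<close> of the extension at \<open>a\<close> must lie above all slopes \<open>(l u - p (u - s a)) / s\<close> and below all
  slopes \<open>(p (w + t a) - l w) / t\<close> with \<open>s, t > 0\<close>.  Every slope of the first kind is at most every
  slope of the second kind: the convex combination of \<open>u - s a\<close> and \<open>w + t a\<close> in which \<open>a\<close> cancels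
  lies in \<open>U\<close>, where \<open>l \<le> p\<close>.  Functionals on a subspace are represented by functionals on the whole
  space, which are compared on that subspace.
\<close>

lemma convex_dominated_extension_step:
  fixes l p :: "'v::real_vector \<Rightarrow> real"
  assumes l: "linear l" and U: "subspace U" and p: "convex_on T p"
    and T: "subspace T" "U \<subseteq> T" "a \<in> T" and a: "a \<notin> U"
    and le: "\<And>u. u \<in> U \<Longrightarrow> l u \<le> p u"
  shows "\<exists>l'. linear l' \<and> (\<forall>u\<in>U. l' u = l u) \<and> (\<forall>u\<in>U. \<forall>t. l' (u + t *\<^sub>R a) \<le> p (u + t *\<^sub>R a))"
proof -
  have slopes: "(l u - p (u - s *\<^sub>R a)) / s \<le> (p (w + t *\<^sub>R a) - l w) / t"
    if "u \<in> U" "w \<in> U" "s > 0" "t > 0" for u w s t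
  proof -
    \<comment> \<open>the weights for which the multiples of \<open>a\<close> cancel\<close>
    let ?c = "t / (s + t)" and ?d = "s / (s + t)"
    have cd: "?c \<ge> 0" "?d \<ge> 0" "?c + ?d = 1"
      using that by (simp_all flip: add_divide_distrib add: add.commute)
    have inT: "u - s *\<^sub>R a \<in> T" "w + t *\<^sub>R a \<in> T"
      using that T by (auto intro!: subspace_add subspace_diff subspace_scale)
    have eq: "?c *\<^sub>R (u - s *\<^sub>R a) + ?d *\<^sub>R (w + t *\<^sub>R a) = ?c *\<^sub>R u + ?d *\<^sub>R w"
      by (simp add: algebra_simps)
    have "?c * l u + ?d * l w = l (?c *\<^sub>R u + ?d *\<^sub>R w)"
      using l by (simp add: linear_add linear_scale)
    also have "\<dots> \<le> p (?c *\<^sub>R u + ?d *\<^sub>R w)"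
      using that U by (intro le subspace_add subspace_scale) auto
    also have "\<dots> \<le> ?c * p (u - s *\<^sub>R a) + ?d * p (w + t *\<^sub>R a)"
      using p inT cd unfolding eq[symmetric] convex_on_def by blast
    finally have "(t * l u + s * l w) / (s + t) \<le> (t * p (u - s *\<^sub>R a) + s * p (w + t *\<^sub>R a)) / (s + t)"
      by (simp add: add_divide_distrib)
    then have "t * l u + s * l w \<le> t * p (u - s *\<^sub>R a) + s * p (w + t *\<^sub>R a)"
      using that by (simp add: divide_le_cancel)
    then show ?thesis
      using that by (simp add: field_simps)
  qed
  define L where "L = {(l u - p (u - s *\<^sub>R a)) / s | u s. u \<in> U \<and> s > 0}"
  define c where "c = Sup L"
  have "0 \<in> U"
    using U by (rule subspace_0)
  then have "L \<noteq> {}"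
    unfolding L_def using zero_less_one by blast
  have c_le: "c \<le> (p (w + t *\<^sub>R a) - l w) / t" if "w \<in> U" "t > 0" for w t
    unfolding c_def using \<open>L \<noteq> {}\<close> that by (intro cSup_least) (auto simp: L_def intro: slopes)
  have le_c: "(l u - p (u - s *\<^sub>R a)) / s \<le> c" if "u \<in> U" "s > 0" for u s
    unfolding c_def
  proof (rule cSup_upper)
    show "(l u - p (u - s *\<^sub>R a)) / s \<in> L"
      using that by (auto simp: L_def)
    show "bdd_above L"
      using slopes[OF _ \<open>0 \<in> U\<close> _ zero_less_one] by (intro bdd_aboveI) (auto simp: L_def)
  qed
  \<comment> \<open>a coordinate along \<open>a\<close> modulo \<open>U\<close>, used to correct the value of \<open>l\<close> at \<open>a\<close> to \<open>c\<close>\<close>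
  obtain g :: "'v \<Rightarrow> real" where g: "linear g" "\<And>u. u \<in> U \<Longrightarrow> g u = 0" "g a = 1"
  proof -
    obtain B where B: "B \<subseteq> U" "independent B" "U \<subseteq> span B"
      using maximal_independent_subset by blast
    have "span B = U"
      using B U by (simp add: span_minimal subset_antisym)
    then have ind: "independent (insert a B)"
      using a B by (simp add: independent_insertI)
    obtain g :: "'v \<Rightarrow> real" where g: "linear g" "\<forall>x\<in>insert a B. g x = (if x = a then 1 else 0)"
      using linear_independent_extend[OF ind, of "\<lambda>x. if x = a then 1 else 0"] by auto
    have "g x = 0" if "x \<in> B" for x
      using that g(2) a B by auto
    then have "g u = 0" if "u \<in> U" for u
      using that linear_eq_0_on_span[OF g(1)] \<open>span B = U\<close> by metis
    then show ?thesis
      using that g by auto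
  qed
  define l' where "l' x = l x + (c - l a) * g x" for x
  have "linear l'"
    unfolding l'_def using l g(1) by (intro linearI) (simp_all add: linear_add linear_scale algebra_simps)
  moreover have l'_U: "l' u = l u" if "u \<in> U" for u
    using g that by (simp add: l'_def)
  moreover have "l' (u + t *\<^sub>R a) \<le> p (u + t *\<^sub>R a)" if u: "u \<in> U" for u t
  proof -
    have "l' a = c"
      using g by (simp add: l'_def)
    then have eq: "l' (u + t *\<^sub>R a) = l u + t * c"
      using \<open>linear l'\<close> l'_U u by (simp add: linear_add linear_scale)
    consider "t > 0" | "t = 0" | "t < 0" by linarith
    then show ?thesis
    proof cases
      case 1
      then show ?thesis
        using c_le[OF u 1] eq by (simp add: field_simps)
    next
      case 2
      then show ?thesis
        using eq le u by simp
    next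
      case 3
      then show ?thesis
        using le_c[OF u, of "- t"] eq by (simp add: field_simps)
    qed
  qed
  ultimately show ?thesis
    by blast
qed

text \<open>
  Hahn-Banach with a convex bound in place of a sublinear one, and with induction on the finite set of
  adjoined vectors in place of Zorn's lemma.
\<close>

proposition convex_dominated_extension:
  fixes l p :: "'v::real_vector \<Rightarrow> real"
  assumes "finite B" and l: "linear l" and U: "subspace U" and p: "convex_on T p"
    and T: "subspace T" "U \<subseteq> T" "B \<subseteq> T"
    and le: "\<And>u. u \<in> U \<Longrightarrow> l u \<le> p u"
  shows "\<exists>l'. linear l' \<and> (\<forall>u\<in>U. l' u = l u) \<and> (\<forall>x\<in>span (U \<union> B). l' x \<le> p x)"
  using \<open>finite B\<close> \<open>B \<subseteq> T\<close>
proof (induction B rule: finite_induct)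
  case empty
  have "span (U \<union> {}) = U"
    using U by simp
  with l le show ?case
    unfolding \<open>span (U \<union> {}) = U\<close> by blast
next
  case (insert a B)
  then obtain l' where l': "linear l'" "\<forall>u\<in>U. l' u = l u" "\<forall>x\<in>span (U \<union> B). l' x \<le> p x"
    by auto
  show ?case
  proof (cases "a \<in> span (U \<union> B)")
    case True
    then have "span (U \<union> insert a B) = span (U \<union> B)"
      by (simp add: span_redundant)
    then show ?thesis
      using l' by auto
  next
    case False
    have sub: "span (U \<union> B) \<subseteq> T"
      using T insert.prems by (intro span_minimal) auto
    have "a \<in> T"
      using insert.prems by simp
    have "\<exists>l''. linear l'' \<and> (\<forall>u\<in>span (U \<union> B). l'' u = l' u)
        \<and> (\<forall>u\<in>span (U \<union> B). \<forall>t. l'' (u + t *\<^sub>R a) \<le> p (u + t *\<^sub>R a))"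
      using l' convex_dominated_extension_step[OF l'(1) subspace_span p T(1) sub \<open>a \<in> T\<close> False]
      by blast
    then obtain l'' where l'': "linear l''" "\<And>u. u \<in> span (U \<union> B) \<Longrightarrow> l'' u = l' u"
        "\<And>u t. u \<in> span (U \<union> B) \<Longrightarrow> l'' (u + t *\<^sub>R a) \<le> p (u + t *\<^sub>R a)"
      by blast
    have "l'' x \<le> p x" if x: "x \<in> span (U \<union> insert a B)" for x
    proof -
      obtain k where "x - k *\<^sub>R a \<in> span (U \<union> B)"
        using x by (auto simp: span_breakdown_eq)
      from l''(3)[OF this, of k] show ?thesis
        by simp
    qed
    moreover have "l'' u = l u" if "u \<in> U" for u
      using that l''(2) l'(2) by (simp add: span_base)
    ultimately show ?thesis
      using l''(1) by blast
  qed
qed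

section \<open>Pulling back and pushing forward vectors\<close>

lemma RR_iff: "x \<in> RR N \<longleftrightarrow> (\<forall>i. i \<notin> N \<longrightarrow> Poly_Mapping.lookup x i = 0)"
  by (auto simp: RR_def in_keys_iff)

lemma lookup_scaleR [simp]: "Poly_Mapping.lookup (r *\<^sub>R x) i = r *\<^sub>R Poly_Mapping.lookup x i"
proof -
  have "finite {i. r *\<^sub>R Poly_Mapping.lookup x i \<noteq> 0}"
    by (rule finite_subset[OF _ finite_keys[of x]]) (auto simp: in_keys_iff)
  then show ?thesis
    by (simp add: scaleR_poly_mapping_def)
qed

lemma subspace_RR: "subspace (RR N)"
  by (simp add: subspace_def RR_iff lookup_add)

lemma RR_empty: "RR {} = {0}"
  by (auto simp: RR_iff intro: poly_mapping_eqI)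

lemma RR_eqI:
  assumes "x \<in> RR N" "y \<in> RR N" "\<And>i. i \<in> N \<Longrightarrow> Poly_Mapping.lookup x i = Poly_Mapping.lookup y i"
  shows "x = y"
  using assms by (metis RR_iff poly_mapping_eqI)

lemma lookup_pullback:
  assumes "finite N"
  shows "Poly_Mapping.lookup (pullback N \<phi> y) i = (if i \<in> N then Poly_Mapping.lookup y (\<phi> i) else 0)"
proof -
  have "finite {i. (if i \<in> N then Poly_Mapping.lookup y (\<phi> i) else 0) \<noteq> 0}"
    by (rule finite_subset[OF _ assms]) auto
  then show ?thesis
    by (simp add: pullback_def)
qed

lemma lookup_pushforward:
  assumes "finite M"
  shows "Poly_Mapping.lookup (pushforward N M \<phi> x) j =
    (if j \<in> M then \<Sum>i\<in>{i\<in>N. \<phi> i = j}. Poly_Mapping.lookup x i else 0)"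
proof -
  have "finite {j. (if j \<in> M then \<Sum>i\<in>{i\<in>N. \<phi> i = j}. Poly_Mapping.lookup x i else 0) \<noteq> 0}"
    by (rule finite_subset[OF _ assms]) auto
  then show ?thesis
    by (simp add: pushforward_def)
qed

lemma pullback_in_RR [simp]: "finite N \<Longrightarrow> pullback N \<phi> y \<in> RR N"
  by (simp add: RR_iff lookup_pullback)

lemma pushforward_in_RR [simp]: "finite M \<Longrightarrow> pushforward N M \<phi> x \<in> RR M"
  by (simp add: RR_iff lookup_pushforward)

lemma linear_pullback: "finite N \<Longrightarrow> linear (pullback N \<phi>)"
  by (intro linearI poly_mapping_eqI) (simp_all add: lookup_pullback lookup_add)

lemma linear_pushforward: "finite M \<Longrightarrow> linear (pushforward N M \<phi>)"
  by (intro linearI poly_mapping_eqI)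
    (simp_all add: lookup_pushforward lookup_add sum.distrib sum_distrib_left)

text \<open>
  Used as congruence rules, the next two facts let the simplifier evaluate a map of finite sets on
  the elements of its domain only, where its value is determined.
\<close>

lemma pullback_cong:
  assumes "N = N'" "\<And>i. i \<in> N' \<Longrightarrow> \<phi> i = \<psi> i" "y = y'"
  shows "pullback N \<phi> y = pullback N' \<psi> y'"
  using assms by (simp add: pullback_def cong: if_cong)

lemma pushforward_cong:
  assumes "N = N'" "M = M'" "\<And>i. i \<in> N' \<Longrightarrow> \<phi> i = \<psi> i" "x = x'"
  shows "pushforward N M \<phi> x = pushforward N' M' \<psi> x'"
proof -
  have "{i\<in>N. \<phi> i = j} = {i\<in>N'. \<psi> i = j}" for j
    using assms by auto
  note eq = this
  show ?thesis
    unfolding pushforward_def eq \<open>M = M'\<close> \<open>x = x'\<close> ..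
qed

lemma pullback_ident: "finite N \<Longrightarrow> x \<in> RR N \<Longrightarrow> pullback N (\<lambda>i. i) x = x"
  by (rule RR_eqI[of _ N]) (simp_all add: lookup_pullback)

lemma pushforward_ident: "finite N \<Longrightarrow> x \<in> RR N \<Longrightarrow> pushforward N N (\<lambda>i. i) x = x"
proof (rule RR_eqI[of _ N])
  fix i assume "finite N" "i \<in> N"
  then have "{i'\<in>N. i' = i} = {i}"
    by auto
  then show "Poly_Mapping.lookup (pushforward N N (\<lambda>i. i) x) i = Poly_Mapping.lookup x i"
    using \<open>finite N\<close> \<open>i \<in> N\<close> by (simp add: lookup_pushforward)
qed simp_all

lemma pullback_pullback:
  assumes "finite N" "finite M" "\<phi> \<in> N \<rightarrow> M"
  shows "pullback N \<phi> (pullback M \<psi> y) = pullback N (\<lambda>i. \<psi> (\<phi> i)) y"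
  using assms by (intro poly_mapping_eqI) (auto simp: lookup_pullback)

lemma pushforward_pushforward:
  assumes "finite N" "finite M" "finite K" "\<phi> \<in> N \<rightarrow> M"
  shows "pushforward M K \<psi> (pushforward N M \<phi> x) = pushforward N K (\<lambda>i. \<psi> (\<phi> i)) x"
proof (rule RR_eqI[of _ K])
  fix k assume "k \<in> K"
  let ?S = "{i\<in>N. \<psi> (\<phi> i) = k}" and ?T = "{j\<in>M. \<psi> j = k}"
  have "(\<Sum>j\<in>?T. \<Sum>i\<in>{i\<in>N. \<phi> i = j}. Poly_Mapping.lookup x i) =
      (\<Sum>j\<in>?T. \<Sum>i\<in>{i\<in>?S. \<phi> i = j}. Poly_Mapping.lookup x i)"
    by (intro sum.cong) auto
  also have "\<dots> = (\<Sum>i\<in>?S. Poly_Mapping.lookup x i)"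
    using assms by (intro sum.group) auto
  finally show "Poly_Mapping.lookup (pushforward M K \<psi> (pushforward N M \<phi> x)) k =
      Poly_Mapping.lookup (pushforward N K (\<lambda>i. \<psi> (\<phi> i)) x) k"
    using assms \<open>k \<in> K\<close> by (simp add: lookup_pushforward)
qed (use assms in simp_all)

definition pairing :: "'i set \<Rightarrow> ('i \<Rightarrow>\<^sub>0 real) \<Rightarrow> ('i \<Rightarrow>\<^sub>0 real) \<Rightarrow> real"
  where "pairing N v x = (\<Sum>i\<in>N. Poly_Mapping.lookup v i * Poly_Mapping.lookup x i)"

lemma linear_pairing: "linear (pairing N v)"
  by (intro linearI) (simp_all add: pairing_def lookup_add sum.distrib sum_distrib_left algebra_simps)

lemma pairing_add_left: "pairing N (v + w) x = pairing N v x + pairing N w x"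
  by (simp add: pairing_def lookup_add sum.distrib algebra_simps)

lemma pairing_pushforward:
  assumes "finite N" "finite M" "\<phi> \<in> N \<rightarrow> M"
  shows "pairing M (pushforward N M \<phi> v) y = pairing N v (pullback N \<phi> y)"
proof -
  have "pairing M (pushforward N M \<phi> v) y =
      (\<Sum>j\<in>M. \<Sum>i\<in>{i\<in>N. \<phi> i = j}. Poly_Mapping.lookup v i * Poly_Mapping.lookup y (\<phi> i))"
    using assms by (auto simp: pairing_def lookup_pushforward sum_distrib_right intro!: sum.cong)
  also have "\<dots> = pairing N v (pullback N \<phi> y)"
    using assms by (subst sum.group) (auto simp: pairing_def lookup_pullback intro!: sum.cong)
  finally show ?thesis .
qed

lemma pairing_single:
  assumes "finite N" "i \<in> N"
  shows "pairing N v (Poly_Mapping.single i 1) = Poly_Mapping.lookup v i"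
  using assms by (simp add: pairing_def lookup_single when_def if_distrib cong: if_cong)

lemma RR_expansion:
  assumes "finite N" "x \<in> RR N"
  shows "x = (\<Sum>i\<in>N. Poly_Mapping.lookup x i *\<^sub>R Poly_Mapping.single i 1)"
proof (rule poly_mapping_eqI)
  fix j
  show "Poly_Mapping.lookup x j =
      Poly_Mapping.lookup (\<Sum>i\<in>N. Poly_Mapping.lookup x i *\<^sub>R Poly_Mapping.single i 1) j"
    using assms by (simp add: lookup_sum lookup_single when_def if_distrib RR_iff cong: if_cong)
qed

text \<open>
  The representing vector lists the values of \<open>l\<close> on the standard basis.
\<close>

lemma linear_functional_eq_pairing:
  fixes l :: "('i \<Rightarrow>\<^sub>0 real) \<Rightarrow> real"
  assumes "finite N" "linear l"
  obtains v where "v \<in> RR N" "\<And>x. x \<in> RR N \<Longrightarrow> l x = pairing N v x"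
proof
  let ?v = "\<Sum>i\<in>N. l (Poly_Mapping.single i 1) *\<^sub>R (Poly_Mapping.single i 1 :: 'i \<Rightarrow>\<^sub>0 real)"
  have v: "Poly_Mapping.lookup ?v j = (if j \<in> N then l (Poly_Mapping.single j 1) else 0)" for j
    using \<open>finite N\<close> by (simp add: lookup_sum lookup_single when_def if_distrib cong: if_cong)
  show "?v \<in> RR N"
    by (simp add: RR_iff v)
  show "l x = pairing N ?v x" if "x \<in> RR N" for x
  proof -
    have "l x = l (\<Sum>i\<in>N. Poly_Mapping.lookup x i *\<^sub>R Poly_Mapping.single i 1)"
      using RR_expansion[OF \<open>finite N\<close> that] by simp
    also have "\<dots> = (\<Sum>i\<in>N. Poly_Mapping.lookup x i * l (Poly_Mapping.single i 1))"
      using \<open>linear l\<close> by (simp add: linear_sum linear_scale)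
    also have "\<dots> = pairing N ?v x"
      unfolding pairing_def v by (intro sum.cong) simp_all
    finally show ?thesis .
  qed
qed

section \<open>The chain rule and the separable sum rule for subdifferentials\<close>

lemma subdifferential_iff:
  "v \<in> subdifferential N f x \<longleftrightarrow> v \<in> RR N \<and> (\<forall>y\<in>RR N. f x + pairing N v (y - x) \<le> f y)"
  by (auto simp: subdifferential_def pairing_def algebra_simps)

lemma subdifferential_cong:
  assumes "x \<in> RR N" "\<And>y. y \<in> RR N \<Longrightarrow> f y = g y"
  shows "subdifferential N f x = subdifferential N g x"
  using assms by (auto simp: subdifferential_def)

text \<open>
  The convexity of \<open>f\<close> is what makes the inclusion from left to right hold, through
  \<open>convex_dominated_extension\<close>, applied to the increment of \<open>f\<close> at
  \<open>\<phi>\<^sup>* y\<close>.  The other inclusion is the adjunction between \<open>\<phi>\<^sub>*\<close> and \<open>\<phi>\<^sup>*\<close>.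
\<close>

theorem subdifferential_pullback:
  assumes fin: "finite N" "finite M" and \<phi>: "\<phi> \<in> N \<rightarrow> M"
    and f: "convex_on (RR N) f" and y: "y \<in> RR M"
  shows "subdifferential M (\<lambda>y. f (pullback N \<phi> y)) y =
    pushforward N M \<phi> ` subdifferential N f (pullback N \<phi> y)"
proof (intro equalityI subsetI)
  fix w assume "w \<in> pushforward N M \<phi> ` subdifferential N f (pullback N \<phi> y)"
  then show "w \<in> subdifferential M (\<lambda>y. f (pullback N \<phi> y)) y"
    using assms by (auto simp: subdifferential_iff pairing_pushforward linear_diff[OF linear_pullback])
next
  fix w assume "w \<in> subdifferential M (\<lambda>y. f (pullback N \<phi> y)) y"
  then have w: "w \<in> RR M"
      "\<And>z. z \<in> RR M \<Longrightarrow> f (pullback N \<phi> y) + pairing M w (z - y) \<le> f (pullback N \<phi> z)"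
    by (auto simp: subdifferential_iff)
  let ?A = "pullback N \<phi>"
  have A: "linear ?A"
    using fin by (simp add: linear_pullback)
  define p where "p h = f (?A y + h) - f (?A y)" for h
  have p: "convex_on (RR N) p"
  proof (rule convex_onI)
    show "convex (RR N)"
      by (simp add: subspace_RR subspace_imp_convex)
    fix t :: real and h k assume *: "0 < t" "t < 1" "h \<in> RR N" "k \<in> RR N"
    have "?A y + ((1 - t) *\<^sub>R h + t *\<^sub>R k) = (1 - t) *\<^sub>R (?A y + h) + t *\<^sub>R (?A y + k)"
      by (simp add: algebra_simps)
    moreover have "?A y + h \<in> RR N" "?A y + k \<in> RR N"
      using * fin by (simp_all add: subspace_RR subspace_add)
    ultimately have "f (?A y + ((1 - t) *\<^sub>R h + t *\<^sub>R k)) \<le>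
        (1 - t) * f (?A y + h) + t * f (?A y + k)"
      using convex_onD[OF f, of t] * by simp
    then show "p ((1 - t) *\<^sub>R h + t *\<^sub>R k) \<le> (1 - t) * p h + t * p k"
      by (simp add: p_def algebra_simps)
  qed
  have w_le: "pairing M w u \<le> p (?A u)" if "u \<in> RR M" for u
    using w(2)[of "y + u"] that y by (simp add: p_def linear_add[OF A] subspace_RR subspace_add)
  have w_ker: "pairing M w u = 0" if "u \<in> RR M" "?A u = 0" for u
    using w_le[of u] w_le[of "- u"] that
    by (simp add: p_def linear_neg[OF A] linear_neg[OF linear_pairing] subspace_RR subspace_neg)
  \<comment> \<open>\<open>w \<circ> g\<close> is the functional that \<open>w\<close> induces on the range, as \<open>w\<close> vanishes on the kernel\<close>
  obtain g where g: "range g \<subseteq> RR M" "linear g" "\<And>x. x \<in> ?A ` RR M \<Longrightarrow> ?A (g x) = x"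
    using linear_exists_right_inverse_on[OF A subspace_RR[of M]] by blast
  define l where "l x = pairing M w (g x)" for x
  have l: "linear l"
    unfolding l_def using linear_compose[OF g(2) linear_pairing] by (simp add: o_def)
  have l_A: "l (?A u) = pairing M w u" if "u \<in> RR M" for u
  proof -
    have "g (?A u) \<in> RR M"
      using g(1) by auto
    then have "pairing M w (g (?A u) - u) = 0"
      using that g(3) by (intro w_ker) (simp_all add: linear_diff[OF A] subspace_RR subspace_diff)
    then show ?thesis
      by (simp add: l_def linear_diff[OF linear_pairing])
  qed
  let ?B = "(\<lambda>i. Poly_Mapping.single i (1::real)) ` N"
  have "?B \<subseteq> RR N"
    by (auto simp: RR_iff lookup_single when_def)
  have "?A ` RR M \<subseteq> RR N"
    using fin by auto
  have le: "l x \<le> p x" if "x \<in> ?A ` RR M" for x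
    using that l_A w_le by auto
  \<comment> \<open>adjoining the standard basis vectors to the range exhausts \<open>\<real>\<^sup>N\<close>\<close>
  have "\<exists>l'. linear l' \<and> (\<forall>x\<in>?A ` RR M. l' x = l x) \<and> (\<forall>x\<in>span (?A ` RR M \<union> ?B). l' x \<le> p x)"
    using fin le \<open>?B \<subseteq> RR N\<close> \<open>?A ` RR M \<subseteq> RR N\<close>
    by (intro convex_dominated_extension[OF _ l _ p])
      (simp_all add: subspace_RR linear_subspace_image[OF A])
  then obtain l' where l': "linear l'" "\<And>x. x \<in> ?A ` RR M \<Longrightarrow> l' x = l x"
      "\<And>x. x \<in> span (?A ` RR M \<union> ?B) \<Longrightarrow> l' x \<le> p x"
    by blast
  obtain v where v: "v \<in> RR N" "\<And>x. x \<in> RR N \<Longrightarrow> l' x = pairing N v x"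
    using linear_functional_eq_pairing[OF fin(1) l'(1)] by blast
  have v_le: "pairing N v h \<le> p h" if "h \<in> RR N" for h
  proof -
    have "h \<in> span (?A ` RR M \<union> ?B)"
      by (subst RR_expansion[OF fin(1) that]) (auto intro!: span_sum span_scale intro: span_base)
    then show ?thesis
      using l'(3) v(2)[OF that] by fastforce
  qed
  have "v \<in> subdifferential N f (?A y)"
    unfolding subdifferential_iff
  proof (intro conjI ballI)
    fix z assume "z \<in> RR N"
    then show "f (?A y) + pairing N v (z - ?A y) \<le> f z"
      using v_le[of "z - ?A y"] fin by (simp add: p_def subspace_RR subspace_diff)
  qed (rule v)
  moreover have "pushforward N M \<phi> v = w"
  proof (rule RR_eqI[of _ M])
    fix j assume "j \<in> M"
    let ?e = "Poly_Mapping.single j (1::real)"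
    have e: "?e \<in> RR M"
      using \<open>j \<in> M\<close> by (auto simp: RR_iff lookup_single when_def)
    have "pairing M (pushforward N M \<phi> v) ?e = pairing N v (?A ?e)"
      using fin \<phi> by (rule pairing_pushforward)
    also have "\<dots> = pairing M w ?e"
      using e v(2)[of "?A ?e"] l'(2)[of "?A ?e"] l_A[OF e] fin by simp
    finally show "Poly_Mapping.lookup (pushforward N M \<phi> v) j = Poly_Mapping.lookup w j"
      using fin \<open>j \<in> M\<close> by (simp add: pairing_single)
  qed (use fin w in simp_all)
  ultimately show "w \<in> pushforward N M \<phi> ` subdifferential N f (?A y)"
    by blast
qed

lemma finite_dsum [simp]: "finite N \<Longrightarrow> finite M \<Longrightarrow> finite (dsum N M)"
  by (simp add: dsum_def)

lemma in_dsum [simp]: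
  "InL i \<in> dsum N M \<longleftrightarrow> i \<in> N" "InR j \<in> dsum N M \<longleftrightarrow> j \<in> M" "Atom a \<notin> dsum N M"
  by (auto simp: dsum_def)

lemma dsum_cases:
  assumes "k \<in> dsum N M"
  obtains i where "i \<in> N" "k = InL i" | j where "j \<in> M" "k = InR j"
  using assms by (auto simp: dsum_def)

lemma lookup_pushforward_InL:
  assumes "finite N" "finite M"
  shows "i \<in> N \<Longrightarrow> Poly_Mapping.lookup (pushforward N (dsum N M) InL x) (InL i) = Poly_Mapping.lookup x i"
    and "Poly_Mapping.lookup (pushforward N (dsum N M) InL x) (InR j) = 0"
proof -
  have "{i'\<in>N. i' = i} = {i}" if "i \<in> N"
    using that by auto
  then show "i \<in> N \<Longrightarrow> Poly_Mapping.lookup (pushforward N (dsum N M) InL x) (InL i) = Poly_Mapping.lookup x i"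
    using assms by (simp add: lookup_pushforward)
qed (use assms in \<open>simp add: lookup_pushforward\<close>)

lemma lookup_pushforward_InR:
  assumes "finite N" "finite M"
  shows "j \<in> M \<Longrightarrow> Poly_Mapping.lookup (pushforward M (dsum N M) InR x) (InR j) = Poly_Mapping.lookup x j"
    and "Poly_Mapping.lookup (pushforward M (dsum N M) InR x) (InL i) = 0"
proof -
  have "{j'\<in>M. j' = j} = {j}" if "j \<in> M"
    using that by auto
  then show "j \<in> M \<Longrightarrow> Poly_Mapping.lookup (pushforward M (dsum N M) InR x) (InR j) = Poly_Mapping.lookup x j"
    using assms by (simp add: lookup_pushforward)
qed (use assms in \<open>simp add: lookup_pushforward\<close>)

text \<open>
  The maps \<open>\<iota>\<^sub>N\<^sub>*\<close>, \<open>\<iota>\<^sub>M\<^sub>*\<close> and \<open>\<iota>\<^sub>N\<^sup>*\<close>, \<open>\<iota>\<^sub>M\<^sup>*\<close> are the injections and projections of a biproduct.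
\<close>

lemma dsum_biproduct:
  assumes "finite N" "finite M"
  shows "x \<in> RR N \<Longrightarrow> pullback N InL (pushforward N (dsum N M) InL x) = x"
    and "y \<in> RR M \<Longrightarrow> pullback M InR (pushforward M (dsum N M) InR y) = y"
    and "pullback M InR (pushforward N (dsum N M) InL x) = 0"
    and "pullback N InL (pushforward M (dsum N M) InR y) = 0"
    and "z \<in> RR (dsum N M) \<Longrightarrow>
      pushforward N (dsum N M) InL (pullback N InL z) + pushforward M (dsum N M) InR (pullback M InR z) = z"
proof -
  assume z: "z \<in> RR (dsum N M)"
  show "pushforward N (dsum N M) InL (pullback N InL z) + pushforward M (dsum N M) InR (pullback M InR z) = z"
  proof (rule RR_eqI[OF _ z])
    fix k assume "k \<in> dsum N M"
    then show "Poly_Mapping.lookup (pushforward N (dsum N M) InL (pullback N InL z) +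
          pushforward M (dsum N M) InR (pullback M InR z)) k = Poly_Mapping.lookup z k"
      using assms by (cases rule: dsum_cases)
        (simp_all add: lookup_add lookup_pushforward_InL lookup_pushforward_InR lookup_pullback)
  qed (use assms in \<open>simp add: subspace_RR subspace_add\<close>)
qed (use assms in \<open>auto simp: lookup_pullback lookup_pushforward_InL lookup_pushforward_InR RR_iff
  intro!: poly_mapping_eqI\<close>)

text \<open>
  A subgradient \<open>u\<close> of the sum splits as \<open>\<iota>\<^sub>N\<^sub>* \<iota>\<^sub>N\<^sup>* u + \<iota>\<^sub>M\<^sub>* \<iota>\<^sub>M\<^sup>* u\<close>.  Moving only one component of the
  point cancels the terms of the other function, which leaves the subgradient inequality for one
  summand.
\<close>

theorem subdifferential_separable_sum:
  assumes fin: "finite N" "finite M"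
  shows "subdifferential (dsum N M) (\<lambda>x. f (pullback N InL x) + g (pullback M InR x)) x =
    pushforward N (dsum N M) InL ` subdifferential N f (pullback N InL x) +
    pushforward M (dsum N M) InR ` subdifferential M g (pullback M InR x)"
    (is "?lhs = ?rhs")
proof (intro equalityI subsetI)
  let ?L = "pullback N InL" and ?R = "pullback M InR"
    and ?L' = "pushforward N (dsum N M) InL" and ?R' = "pushforward M (dsum N M) InR"
  have InLR: "InL \<in> N \<rightarrow> dsum N M" "InR \<in> M \<rightarrow> dsum N M"
    by auto
  have pair: "pairing (dsum N M) (?L' v + ?R' w) z = pairing N v (?L z) + pairing M w (?R z)" for v w z
    using fin by (simp add: pairing_add_left pairing_pushforward InLR)
  note lins = linear_diff[OF linear_pullback] linear_add[OF linear_pullback]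
  {
    fix u assume "u \<in> ?rhs"
    then obtain v w where u: "u = ?L' v + ?R' w"
        and v: "v \<in> subdifferential N f (?L x)" and w: "w \<in> subdifferential M g (?R x)"
      by (auto simp: set_plus_def)
    show "u \<in> ?lhs"
      unfolding subdifferential_iff
    proof (intro conjI ballI)
      show "u \<in> RR (dsum N M)"
        using fin by (simp add: u subspace_RR subspace_add)
      fix y assume "y \<in> RR (dsum N M)"
      have "f (?L x) + pairing N v (?L y - ?L x) \<le> f (?L y)"
        using v fin by (simp add: subdifferential_iff)
      moreover have "g (?R x) + pairing M w (?R y - ?R x) \<le> g (?R y)"
        using w fin by (simp add: subdifferential_iff)
      ultimately show "f (?L x) + g (?R x) + pairing (dsum N M) u (y - x) \<le> f (?L y) + g (?R y)"
        using fin by (simp add: u pair lins)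
    qed
  next
    fix u assume "u \<in> ?lhs"
    then have u: "u \<in> RR (dsum N M)" and sub: "\<And>y. y \<in> RR (dsum N M) \<Longrightarrow>
        f (?L x) + g (?R x) + pairing (dsum N M) u (y - x) \<le> f (?L y) + g (?R y)"
      by (auto simp: subdifferential_iff)
    have u_eq: "?L' (?L u) + ?R' (?R u) = u"
      using fin u by (simp add: dsum_biproduct)
    have sub': "f (?L x) + g (?R x) + pairing N (?L u) (a - ?L x) + pairing M (?R u) (b - ?R x)
        \<le> f a + g b" if "a \<in> RR N" "b \<in> RR M" for a b
    proof -
      let ?y = "?L' a + ?R' b"
      have "?y \<in> RR (dsum N M)" and y: "?L ?y = a" "?R ?y = b"
        using fin that by (simp_all add: lins dsum_biproduct subspace_RR subspace_add)
      from sub[OF this(1)] show ?thesis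
        using fin pair[of "?L u" "?R u" "?y - x"] by (simp add: u_eq lins(1) y)
    qed
    have zero: "pairing K v 0 = 0" for K and v :: "'a elem \<Rightarrow>\<^sub>0 real"
      by (simp add: pairing_def)
    have "?L u \<in> subdifferential N f (?L x)"
      using sub'[OF _ pullback_in_RR[OF fin(2)], of _ InR x] fin
      by (auto simp: subdifferential_iff zero)
    moreover have "?R u \<in> subdifferential M g (?R x)"
      using sub'[OF pullback_in_RR[OF fin(1)], of _ InL x] fin
      by (auto simp: subdifferential_iff zero)
    ultimately show "u \<in> ?rhs"
      using u_eq by (metis imageI set_plus_intro)
  }
qed

section \<open>The lax symmetric monoidal functors\<close>

lemma dsum_maps [simp]:
  "i \<in> N \<Longrightarrow> dsum_map N M \<phi> \<psi> (InL i) = InL (\<phi> i)"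
  "j \<in> M \<Longrightarrow> dsum_map N M \<phi> \<psi> (InR j) = InR (\<psi> j)"
  "i \<in> N \<Longrightarrow> dsum_assoc N M K (InL (InL i)) = InL i"
  "j \<in> M \<Longrightarrow> dsum_assoc N M K (InL (InR j)) = InR (InL j)"
  "k \<in> K \<Longrightarrow> dsum_assoc N M K (InR k) = InR (InR k)"
  "i \<in> N \<Longrightarrow> dsum_lunit N (InR i) = i"
  "i \<in> N \<Longrightarrow> dsum_runit N (InL i) = i"
  "i \<in> N \<Longrightarrow> dsum_swap N M (InL i) = InR i"
  "j \<in> M \<Longrightarrow> dsum_swap N M (InR j) = InL j"
  by (simp_all add: dsum_map_def dsum_assoc_def dsum_lunit_def dsum_runit_def dsum_swap_def)

lemma dsum_maps_in [simp]:
  "InL \<in> N \<rightarrow> dsum N M"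
  "InR \<in> M \<rightarrow> dsum N M"
  "\<phi> \<in> N \<rightarrow> N' \<Longrightarrow> \<psi> \<in> M \<rightarrow> M' \<Longrightarrow> dsum_map N M \<phi> \<psi> \<in> dsum N M \<rightarrow> dsum N' M'"
  "dsum_assoc N M K \<in> dsum (dsum N M) K \<rightarrow> dsum N (dsum M K)"
  "dsum_lunit N \<in> dsum {} N \<rightarrow> N"
  "dsum_runit N \<in> dsum N {} \<rightarrow> N"
  "dsum_swap N M \<in> dsum N M \<rightarrow> dsum M N"
  by (auto elim!: dsum_cases)

lemma convex_on_restrict: "convex_on S (restrict f S) \<longleftrightarrow> convex_on S f"
  by (auto simp: convex_on_def convex_def)

lemma convex_on_pullback:
  assumes "finite N" "convex_on (RR N) f"
  shows "convex_on (RR M) (\<lambda>y. f (pullback N \<phi> y))"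
  using assms subspace_imp_convex[OF subspace_RR[of M]]
  by (simp add: convex_on_def linear_add[OF linear_pullback] linear_scale[OF linear_pullback])

text \<open>
  The laws are checked pointwise on \<open>\<real>\<^sup>N\<close>.  For this, the values of the structure maps are kept opaque:
  they are known to be elements of the right set and can be evaluated at a vector.
\<close>

lemma Conv_ob_eqI:
  assumes "f \<in> Conv_ob N" "g \<in> Conv_ob N" "\<And>x. x \<in> RR N \<Longrightarrow> f x = g x"
  shows "f = g"
  using assms by (auto simp: Conv_ob_def intro: PiE_ext[of _ _ "\<lambda>_. UNIV"])

lemma Conv_obD: "f \<in> Conv_ob N \<Longrightarrow> convex_on (RR N) f"
  by (simp add: Conv_ob_def)

lemma Ob_Conv [simp]: "Ob Conv = Conv_ob"
  by (simp add: Conv_def)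

lemma Mor_Conv_extensional: "Mor Conv N M \<phi> \<in> extensional (Conv_ob N)"
  by (simp add: Conv_def)

lemma Mor_Conv_in [simp]:
  "finite N \<Longrightarrow> f \<in> Conv_ob N \<Longrightarrow> Mor Conv N M \<phi> f \<in> Conv_ob M"
  using convex_on_pullback[OF _ Conv_obD]
  by (simp add: Conv_def) (simp add: Conv_ob_def convex_on_restrict)

lemma Mor_Conv_apply [simp]:
  "f \<in> Conv_ob N \<Longrightarrow> y \<in> RR M \<Longrightarrow> Mor Conv N M \<phi> f y = f (pullback N \<phi> y)"
  by (simp add: Conv_def)

lemma ProdCmp_Conv_extensional: "ProdCmp Conv N M \<in> extensional (Conv_ob N \<times> Conv_ob M)"
  by (simp add: Conv_def)

lemma ProdCmp_Conv_in [simp]: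
  assumes "finite N" "finite M" "f \<in> Conv_ob N" "g \<in> Conv_ob M"
  shows "ProdCmp Conv N M (f, g) \<in> Conv_ob (dsum N M)"
proof -
  have "convex_on (RR (dsum N M)) (\<lambda>x. f (pullback N InL x) + g (pullback M InR x))"
    using assms by (intro convex_on_add convex_on_pullback Conv_obD)
  then show ?thesis
    using assms by (simp add: Conv_def) (simp add: Conv_ob_def convex_on_restrict)
qed

lemma ProdCmp_Conv_apply [simp]:
  "f \<in> Conv_ob N \<Longrightarrow> g \<in> Conv_ob M \<Longrightarrow> x \<in> RR (dsum N M) \<Longrightarrow>
    ProdCmp Conv N M (f, g) x = f (pullback N InL x) + g (pullback M InR x)"
  by (simp add: Conv_def)

lemma UnitCmp_Conv_in [simp]: "UnitCmp Conv u \<in> Conv_ob {}"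
  by (simp add: Conv_def Conv_ob_def convex_on_restrict) (simp add: convex_on_def RR_empty)

lemma UnitCmp_Conv_apply [simp]: "x \<in> RR {} \<Longrightarrow> UnitCmp Conv u x = 0"
  by (simp add: Conv_def)

lemma lax_symmetric_monoidal_functor_Conv: "lax_symmetric_monoidal_functor Conv"
proof (intro lax_symmetric_monoidal_functor.intro, goal_cases)
  case (1 N M \<phi>)
  then show ?case
    using Mor_Conv_extensional by (auto simp: PiE_def)
next
  case (2 N)
  show ?case
  proof (rule extensionalityI[of _ "Conv_ob N"])
    fix f assume "f \<in> Conv_ob N"
    then show "Mor Conv N N (restrict id N) f = restrict id (Ob Conv N) f"
      using 2 by (intro Conv_ob_eqI[of _ N]) (simp_all add: pullback_ident cong: pullback_cong)
  qed (simp_all add: Mor_Conv_extensional)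
next
  case (3 N M K \<phi> \<psi>)
  show ?case
  proof (rule extensionalityI[of _ "Conv_ob N"])
    fix f assume "f \<in> Conv_ob N"
    then show "Mor Conv N K (compose N \<psi> \<phi>) f = compose (Ob Conv N) (Mor Conv M K \<psi>) (Mor Conv N M \<phi>) f"
      using 3 by (intro Conv_ob_eqI[of _ K])
        (simp_all add: compose_eq pullback_pullback PiE_def cong: pullback_cong)
  qed (simp_all add: Mor_Conv_extensional)
next
  case (4 N M)
  then show ?case
    using ProdCmp_Conv_extensional by (auto simp: PiE_def)
next
  case 5
  show ?case by simp
next
  case (6 N N' M M' \<phi> \<psi> f g)
  then show ?case
    by (intro Conv_ob_eqI[of _ "dsum N' M'"])
      (simp_all add: PiE_def pullback_pullback cong: pullback_cong)
next
  case (7 N M K f g h)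
  then show ?case
    by (intro Conv_ob_eqI[of _ "dsum N (dsum M K)"])
      (simp_all add: pullback_pullback cong: pullback_cong)
next
  case (8 N f)
  then show ?case
    by (intro Conv_ob_eqI[of _ N])
      (simp_all add: pullback_pullback pullback_ident cong: pullback_cong)
next
  case (9 N f)
  then show ?case
    by (intro Conv_ob_eqI[of _ N])
      (simp_all add: pullback_pullback pullback_ident cong: pullback_cong)
next
  case (10 N M f g)
  then show ?case
    by (intro Conv_ob_eqI[of _ "dsum M N"])
      (simp_all add: pullback_pullback cong: pullback_cong)
qed

text \<open>
  For \<open>NDD\<close> the same laws hold by distributing pushforwards over Minkowski sums and collapsing
  composites; the rules doing this are collected in \<open>pushforward_simps\<close>.
\<close>

lemma linear_image_set_plus: "linear h \<Longrightarrow> h ` (A + B) = h ` A + h ` B"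
  by (force simp: set_plus_def linear_add image_iff)

lemma pushforward_ident_image:
  "finite N \<Longrightarrow> A \<subseteq> RR N \<Longrightarrow> pushforward N N (\<lambda>i. i) ` A = A"
  by (force simp: pushforward_ident subset_iff image_iff)

lemma zero_set_plus: "{0} + A = A" "A + {0} = A" for A :: "'b::comm_monoid_add set"
  by (simp_all flip: set_zero)

lemmas pushforward_simps = linear_image_set_plus[OF linear_pushforward] image_image
  pushforward_pushforward pullback_pullback linear_0[OF linear_pushforward]
  zero_set_plus pullback_ident pushforward_ident_image

lemma NDD_ob_eqI:
  assumes "\<upsilon> \<in> NDD_ob N" "\<rho> \<in> NDD_ob N" "\<And>x. x \<in> RR N \<Longrightarrow> \<upsilon> x = \<rho> x"
  shows "\<upsilon> = \<rho>"
  using assms unfolding NDD_ob_def by (rule PiE_ext)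

lemma NDD_obD: "\<upsilon> \<in> NDD_ob N \<Longrightarrow> x \<in> RR N \<Longrightarrow> \<upsilon> x \<subseteq> RR N"
  by (auto simp: NDD_ob_def)

lemma Ob_NDD [simp]: "Ob NDD = NDD_ob"
  by (simp add: NDD_def)

lemma Mor_NDD_extensional: "Mor NDD N M \<phi> \<in> extensional (NDD_ob N)"
  by (simp add: NDD_def)

lemma Mor_NDD_in [simp]:
  "finite M \<Longrightarrow> \<upsilon> \<in> NDD_ob N \<Longrightarrow> Mor NDD N M \<phi> \<upsilon> \<in> NDD_ob M"
  by (simp add: NDD_def) (auto simp: NDD_ob_def)

lemma Mor_NDD_apply [simp]:
  "\<upsilon> \<in> NDD_ob N \<Longrightarrow> y \<in> RR M \<Longrightarrow> Mor NDD N M \<phi> \<upsilon> y = pushforward N M \<phi> ` \<upsilon> (pullback N \<phi> y)"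
  by (simp add: NDD_def)

lemma ProdCmp_NDD_extensional: "ProdCmp NDD N M \<in> extensional (NDD_ob N \<times> NDD_ob M)"
  by (simp add: NDD_def)

lemma ProdCmp_NDD_in [simp]:
  "finite N \<Longrightarrow> finite M \<Longrightarrow> \<upsilon> \<in> NDD_ob N \<Longrightarrow> \<rho> \<in> NDD_ob M \<Longrightarrow>
    ProdCmp NDD N M (\<upsilon>, \<rho>) \<in> NDD_ob (dsum N M)"
  by (simp add: NDD_def) (auto simp: NDD_ob_def set_plus_def subspace_RR intro!: subspace_add)

lemma ProdCmp_NDD_apply [simp]:
  "\<upsilon> \<in> NDD_ob N \<Longrightarrow> \<rho> \<in> NDD_ob M \<Longrightarrow> x \<in> RR (dsum N M) \<Longrightarrow>
    ProdCmp NDD N M (\<upsilon>, \<rho>) x =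
      pushforward N (dsum N M) InL ` \<upsilon> (pullback N InL x) +
      pushforward M (dsum N M) InR ` \<rho> (pullback M InR x)"
  by (simp add: NDD_def)

lemma UnitCmp_NDD_in [simp]: "UnitCmp NDD u \<in> NDD_ob {}"
  by (simp add: NDD_def NDD_ob_def RR_empty)

lemma UnitCmp_NDD_apply [simp]: "x \<in> RR {} \<Longrightarrow> UnitCmp NDD u x = {0}"
  by (simp add: NDD_def)

lemma lax_symmetric_monoidal_functor_NDD: "lax_symmetric_monoidal_functor NDD"
proof (intro lax_symmetric_monoidal_functor.intro, goal_cases)
  case (1 N M \<phi>)
  then show ?case
    using Mor_NDD_extensional by (auto simp: PiE_def)
next
  case (2 N)
  show ?case
  proof (rule extensionalityI[of _ "NDD_ob N"])
    fix \<upsilon> assume "\<upsilon> \<in> NDD_ob N"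
    then show "Mor NDD N N (restrict id N) \<upsilon> = restrict id (Ob NDD N) \<upsilon>"
      using 2 by (intro NDD_ob_eqI[of _ N])
        (simp_all add: pushforward_simps NDD_obD cong: pullback_cong pushforward_cong)
  qed (simp_all add: Mor_NDD_extensional)
next
  case (3 N M K \<phi> \<psi>)
  show ?case
  proof (rule extensionalityI[of _ "NDD_ob N"])
    fix \<upsilon> assume "\<upsilon> \<in> NDD_ob N"
    then show "Mor NDD N K (compose N \<psi> \<phi>) \<upsilon> = compose (Ob NDD N) (Mor NDD M K \<psi>) (Mor NDD N M \<phi>) \<upsilon>"
      using 3 by (intro NDD_ob_eqI[of _ K])
        (simp_all add: compose_eq pushforward_simps PiE_def cong: pullback_cong pushforward_cong)
  qed (simp_all add: Mor_NDD_extensional)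
next
  case (4 N M)
  then show ?case
    using ProdCmp_NDD_extensional by (auto simp: PiE_def)
next
  case 5
  show ?case by simp
next
  case (6 N N' M M' \<phi> \<psi> \<upsilon> \<rho>)
  then show ?case
    by (intro NDD_ob_eqI[of _ "dsum N' M'"])
      (simp_all add: PiE_def pushforward_simps cong: pullback_cong pushforward_cong)
next
  case (7 N M K \<upsilon> \<rho> \<sigma>)
  then show ?case
    by (intro NDD_ob_eqI[of _ "dsum N (dsum M K)"])
      (simp_all add: pushforward_simps add.assoc cong: pullback_cong pushforward_cong)
next
  case (8 N \<upsilon>)
  then show ?case
    by (intro NDD_ob_eqI[of _ N])
      (simp_all add: pushforward_simps NDD_obD cong: pullback_cong pushforward_cong)
next
  case (9 N \<upsilon>)
  then show ?case
    by (intro NDD_ob_eqI[of _ N])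
      (simp_all add: pushforward_simps NDD_obD cong: pullback_cong pushforward_cong)
next
  case (10 N M \<upsilon> \<rho>)
  then show ?case
    by (intro NDD_ob_eqI[of _ "dsum M N"])
      (simp_all add: pushforward_simps add.commute cong: pullback_cong pushforward_cong)
qed

section \<open>The transformation\<close>

text \<open>
  The restrictions to \<open>Conv_ob N\<close> and \<open>RR N\<close> make both the component and its values maps in the sense of
  \<open>\<rightarrow>\<^sub>E\<close>.
\<close>

definition neg_subdifferential :: "'a elem set \<Rightarrow> (('a elem \<Rightarrow>\<^sub>0 real) \<Rightarrow> real) \<Rightarrow> ('a elem \<Rightarrow>\<^sub>0 real) \<Rightarrow> ('a elem \<Rightarrow>\<^sub>0 real) set"
  where "neg_subdifferential N = (\<lambda>f\<in>Conv_ob N. \<lambda>x\<in>RR N. uminus ` subdifferential N f x)"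

lemma neg_subdifferential_in [simp]: "f \<in> Conv_ob N \<Longrightarrow> neg_subdifferential N f \<in> NDD_ob N"
  by (auto simp: neg_subdifferential_def NDD_ob_def subdifferential_def subspace_RR intro!: subspace_neg)

lemma neg_subdifferential_apply [simp]:
  "f \<in> Conv_ob N \<Longrightarrow> x \<in> RR N \<Longrightarrow> neg_subdifferential N f x = uminus ` subdifferential N f x"
  by (simp add: neg_subdifferential_def)

lemma linear_image_uminus: "linear h \<Longrightarrow> uminus ` h ` A = h ` uminus ` A"
  by (simp add: image_image linear_neg)

text \<open>
  After the sign has been moved through the linear pushforwards, naturality is the chain rule and
  compatibility with the product comparisons is the separable sum rule.  At the unit, both sides are
  \<open>{0}\<close> because \<open>\<real>\<^sup>0\<close> is a point.
\<close>

lemma monoidal_natural_transformation_neg_subdifferential: "monoidal_natural_transformation Conv NDD neg_subdifferential"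
proof (intro monoidal_natural_transformation.intro monoidal_natural_transformation_axioms.intro
    lax_symmetric_monoidal_functor_Conv lax_symmetric_monoidal_functor_NDD, goal_cases)
  case (1 N)
  have "neg_subdifferential N \<in> extensional (Conv_ob N)"
    by (simp add: neg_subdifferential_def)
  then show ?case
    by (simp add: PiE_def)
next
  case (2 N M \<phi>)
  have "neg_subdifferential M (Mor Conv N M \<phi> f) = Mor NDD N M \<phi> (neg_subdifferential N f)" if f: "f \<in> Conv_ob N" for f
  proof (rule NDD_ob_eqI[of _ M])
    fix y assume y: "y \<in> RR M"
    have "subdifferential M (Mor Conv N M \<phi> f) y = subdifferential M (\<lambda>y. f (pullback N \<phi> y)) y"
      using y f by (intro subdifferential_cong) simp_all
    also have "\<dots> = pushforward N M \<phi> ` subdifferential N f (pullback N \<phi> y)"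
      using 2 y Conv_obD[OF f] by (intro subdifferential_pullback) (simp_all add: PiE_def)
    finally show "neg_subdifferential M (Mor Conv N M \<phi> f) y = Mor NDD N M \<phi> (neg_subdifferential N f) y"
      using 2 f y by (simp add: linear_image_uminus[OF linear_pushforward])
  qed (use 2 f in simp_all)
  then show ?case
    by (simp add: compose_def cong: restrict_cong)
next
  case (3 N M f g)
  show ?case
  proof (rule NDD_ob_eqI[of _ "dsum N M"])
    fix x assume x: "x \<in> RR (dsum N M)"
    have "subdifferential (dsum N M) (ProdCmp Conv N M (f, g)) x =
        subdifferential (dsum N M) (\<lambda>x. f (pullback N InL x) + g (pullback M InR x)) x"
      using 3 x by (intro subdifferential_cong) simp_all
    also have "\<dots> = pushforward N (dsum N M) InL ` subdifferential N f (pullback N InL x) +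
        pushforward M (dsum N M) InR ` subdifferential M g (pullback M InR x)"
      using 3 by (intro subdifferential_separable_sum)
    finally show "neg_subdifferential (dsum N M) (ProdCmp Conv N M (f, g)) x =
        ProdCmp NDD N M (neg_subdifferential N f, neg_subdifferential M g) x"
      using 3 x by (simp add: linear_image_set_plus[OF linear_uminus]
          linear_image_uminus[OF linear_pushforward])
  qed (use 3 in simp_all)
next
  case 4
  show ?case
  proof (rule NDD_ob_eqI[of _ "{}"])
    fix x :: "'a elem \<Rightarrow>\<^sub>0 real" assume "x \<in> RR {}"
    moreover from this have "subdifferential {} (UnitCmp Conv ()) x = {0}"
      by (auto simp: subdifferential_def RR_empty)
    ultimately show "neg_subdifferential {} (UnitCmp Conv ()) x = UnitCmp NDD () x"
      by simp
  qed simp_all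
qed

theorem theorem5p6:
  shows "\<exists>subg :: 'a elem set \<Rightarrow> (('a elem \<Rightarrow>\<^sub>0 real) \<Rightarrow> real) \<Rightarrow> ('a elem \<Rightarrow>\<^sub>0 real) \<Rightarrow> ('a elem \<Rightarrow>\<^sub>0 real) set.
    monoidal_natural_transformation Conv NDD subg \<and>
    (\<forall>N. finite N \<longrightarrow> (\<forall>f\<in>Ob Conv N. \<forall>x\<in>RR N.
      subg N f x = {- v | v. v \<in> subdifferential N f x}))"
proof (intro exI[of _ neg_subdifferential] conjI allI impI ballI)
  show "monoidal_natural_transformation Conv NDD neg_subdifferential"
    by (rule monoidal_natural_transformation_neg_subdifferential)
  show "neg_subdifferential N f x = {- v | v. v \<in> subdifferential N f x}"
    if "f \<in> Ob Conv N" "x \<in> RR N" for N :: "'a elem set" and f x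
    using that by (auto simp: neg_subdifferential_def)
qed

end
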